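(* Any asymptotically exact streaming algorithm for $k$-median with $k\ge2$, respectively for $k$-means with $k\ge3$, uses $\Omega(n)$ memory.
   Context: The input is a stream of points in $\mathbb{R}^d$ (the hardness already holds in dimension $d=2$). The $k$-means (resp. $k$-median) problem on the prefix $P^{(n)}$ of the first $n$ points asks for a set $C$ of $k$ centers minimizing $\sum_{p\in P^{(n)}}\mathrm{dist}(p,C)^2$ (resp. $\sum_{p\in P^{(n)}}\mathrm{dist}(p,C)$), with $\mathrm{dist}(p,C)=\min_{c\in C}\|p-c\|$. An asymptotically exact streaming algorithm is a one-pass algorithm that, on an infinite stream, after every prefix of length $n$ outputs $k$ centers whose cost divided by the optimal cost for that prefix tends to $1$ as $n\to\infty$ with probability at least $1-\delta$ ($\delta<1/2$). The claim is that any such algorithm uses $\Omega(n)$ bits of memory in the worst case. *)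

theory Defs
  imports "HOL-Probability.Probability" "HOL-Library.Landau_Symbols"
begin

section \<open>Clustering the prefixes of a stream\<close>

text \<open>A stream is a function \<open>P\<close> on the naturals; its prefix of length \<open>n\<close> consists of
  \<open>P 0, \<dots>, P (n - 1)\<close>, counted with multiplicity.\<close>

definition kmedian_cost :: "(nat \<Rightarrow> real ^ 'd) \<Rightarrow> nat \<Rightarrow> (real ^ 'd) set \<Rightarrow> real" where
  "kmedian_cost P n C = (\<Sum>i<n. infdist (P i) C)"

definition kmeans_cost :: "(nat \<Rightarrow> real ^ 'd) \<Rightarrow> nat \<Rightarrow> (real ^ 'd) set \<Rightarrow> real" where
  "kmeans_cost P n C = (\<Sum>i<n. (infdist (P i) C)\<^sup>2)"

type_synonym 'd clustering_cost = "(nat \<Rightarrow> real ^ 'd) \<Rightarrow> nat \<Rightarrow> (real ^ 'd) set \<Rightarrow> real"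

definition opt_cost :: "'d::finite clustering_cost \<Rightarrow> nat \<Rightarrow> (nat \<Rightarrow> real ^ 'd) \<Rightarrow> nat \<Rightarrow> real" where
  "opt_cost cost k P n = (INF C\<in>{C. finite C \<and> card C = k}. cost P n C)"

section \<open>Randomized one-pass algorithms with bit memory\<close>

text \<open>All randomness is drawn once, as a seed \<open>\<omega>\<close> from the probability space \<open>coins\<close>. Reading
  the seed and the number of points seen so far is free of charge; only the bit string carried
  from one point to the next counts as memory. This subsumes algorithms that flip fresh coins in
  every step, and makes the lower bound apply to non-uniform algorithms as well.\<close>

record ('r, 'd) streaming_alg =
  coins :: "'r measure"
  init :: "'r \<Rightarrow> bool list"
  step :: "'r \<Rightarrow> nat \<Rightarrow> bool list \<Rightarrow> real ^ 'd \<Rightarrow> bool list"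
  centers :: "'r \<Rightarrow> nat \<Rightarrow> bool list \<Rightarrow> (real ^ 'd) set"

primrec memory_state ::
  "('r, 'd) streaming_alg \<Rightarrow> 'r \<Rightarrow> (nat \<Rightarrow> real ^ 'd) \<Rightarrow> nat \<Rightarrow> bool list" where
  "memory_state A \<omega> P 0 = init A \<omega>"
| "memory_state A \<omega> P (Suc n) = step A \<omega> n (memory_state A \<omega> P n) (P n)"

definition output_centers ::
  "('r, 'd) streaming_alg \<Rightarrow> 'r \<Rightarrow> (nat \<Rightarrow> real ^ 'd) \<Rightarrow> nat \<Rightarrow> (real ^ 'd) set" where
  "output_centers A \<omega> P n = centers A \<omega> n (memory_state A \<omega> P n)"

text \<open>\<open>X\<close> is the set of points that may occur in the stream. The quotient of the costs is
  meaningful only once the optimal cost is positive, i.e. once the stream has shown more than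
  \<open>k\<close> distinct points, so convergence is demanded exactly on the streams where this
  eventually happens.\<close>

definition asymptotically_exact ::
  "'d::finite clustering_cost \<Rightarrow> nat \<Rightarrow> real \<Rightarrow> (real ^ 'd) set \<Rightarrow> ('r, 'd) streaming_alg \<Rightarrow> bool" where
  "asymptotically_exact cost k \<delta> X A \<longleftrightarrow>
     prob_space (coins A) \<and>
     (\<forall>P. range P \<subseteq> X \<longrightarrow>
        (\<forall>\<omega>\<in>space (coins A). \<forall>n.
           finite (output_centers A \<omega> P n) \<and> card (output_centers A \<omega> P n) = k) \<and>
        ((\<forall>\<^sub>F n in sequentially. opt_cost cost k P n > 0) \<longrightarrow>
           measure (coins A)
             {\<omega> \<in> space (coins A).
                (\<lambda>n. cost P n (output_centers A \<omega> P n) / opt_cost cost k P n)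
                  \<longlonglongrightarrow> 1} \<ge> 1 - \<delta>))"

definition integer_points :: "(real ^ 'd) set" where
  "integer_points = {p. \<forall>j. p $ j \<in> \<int>}"

text \<open>With points of unbounded precision, already the first few of them can force any number
  of bits, for the trivial reason that they have to be read. The worst case over prefixes of length
  \<open>n\<close> is therefore taken over points that are described by \<open>O(log n)\<close> bits per coordinate,
  namely integer points with coordinates between \<open>-n\<close> and \<open>n\<close>. A bound over a
  larger class of prefixes is in particular a bound over these.\<close>

definition uses_memory :: "('r, 'd::finite) streaming_alg \<Rightarrow> (nat \<Rightarrow> nat) \<Rightarrow> bool" where
  "uses_memory A s \<longleftrightarrow>
     (\<forall>n P. (\<forall>i<n. P i \<in> integer_points \<and> (\<forall>j. \<bar>P i $ j\<bar> \<le> real n)) \<longrightarrow>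
        (AE \<omega> in coins A. length (memory_state A \<omega> P n) \<le> s n))"

end

theory Submission
  imports Defs
begin

text \<open>The proof is a reduction from the one-way communication problem INDEX. A set \<open>S \<subseteq> {..<m}\<close> is
  written into a prefix of \<open>n = O(m)\<close> integer points on a line, the bit \<open>i \<in> S\<close> shifting the \<open>i\<close>-th
  point by one. The stream continues with finitely many points depending on a query \<open>i\<close> and then
  repeats \<open>k - 1\<close> fixed points forever. The optimal cost stays bounded, so centers with cost ratio tending
  to 1 must converge to these points, except for one free center, which must converge to the exact
  optimum for the finitely many remaining points; the query is chosen such that this optimum
  reveals whether \<open>i \<in> S\<close>. Hence, for every seed, the memory state after \<open>n\<close> points determines the
  bit \<open>i \<in> S\<close> on all pairs \<open>(S, i)\<close> on which the algorithm succeeds. With \<open>o(m)\<close> bits of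
  memory these are little more than half of the pairs, whereas on average over the seed they are at least
  a fraction \<open>1 - \<delta> > 1 / 2\<close>. As only finitely many streams are involved, no joint measurability in
  seed and stream is needed.\<close>

section \<open>The INDEX problem\<close>

text \<open>The exponential of the agreement is a product with one factor per element of
  \<open>I\<close>. Whatever \<open>Y\<close> is, one of the two choices for that element
  contributes \<open>exp l\<close> and the other 1, so the sum over \<open>S\<close>
  factorizes.\<close>

lemma sum_exp_agreement:
  fixes l :: real
  assumes "finite I"
  shows "(\<Sum>S\<in>Pow I. exp (l * real (card {i\<in>I. i \<in> S \<longleftrightarrow> i \<in> Y}))) = (1 + exp l) ^ card I"
proof -
  define f1 where "f1 i = (if i \<in> Y then exp l else 1)" for i
  define f2 where "f2 i = (if i \<in> Y then 1 else exp l)" for i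
  have "exp (l * real (card {i\<in>I. i \<in> S \<longleftrightarrow> i \<in> Y})) = prod f1 S * prod f2 (I - S)"
    if "S \<subseteq> I" for S
  proof -
    have fin: "finite S" using that assms by (rule finite_subset)
    have "{i\<in>I. i \<in> S \<longleftrightarrow> i \<in> Y} = (S \<inter> Y) \<union> ((I - S) \<inter> - Y)" using that by auto
    then have "card {i\<in>I. i \<in> S \<longleftrightarrow> i \<in> Y} = card (S \<inter> Y) + card ((I - S) \<inter> - Y)"
      using fin assms by (simp only:) (rule card_Un_disjoint, auto)
    moreover have "prod f1 S = exp l ^ card (S \<inter> Y)"
      unfolding f1_def using fin by (simp add: prod.If_cases)
    moreover have "prod f2 (I - S) = exp l ^ card ((I - S) \<inter> - Y)"
      unfolding f2_def using assms by (simp add: prod.If_cases)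
    ultimately show ?thesis
      by (simp add: exp_of_nat_mult[symmetric] mult.commute distrib_left exp_add)
  qed
  then have "(\<Sum>S\<in>Pow I. exp (l * real (card {i\<in>I. i \<in> S \<longleftrightarrow> i \<in> Y})))
      = (\<Sum>S\<in>Pow I. prod f1 S * prod f2 (I - S))"
    by (intro sum.cong) auto
  also have "\<dots> = (\<Prod>i\<in>I. f1 i + f2 i)"
    using assms by (simp add: prod_add)
  also have "\<dots> = (\<Prod>i\<in>I. 1 + exp l)"
    by (intro prod.cong) (auto simp: f1_def f2_def)
  finally show ?thesis by simp
qed

text \<open>As in Chernoff's bound, average \<open>exp (l * agreement)\<close> and take a union bound over the messages \<open>f S\<close>.\<close>

lemma index_agreement_bound:
  fixes f :: "'a set \<Rightarrow> 'b" and Y :: "'b \<Rightarrow> 'a set" and l K :: real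
  assumes "finite I" "l > 0" and K: "real (card (f ` Pow I)) \<le> K"
  shows "(\<Sum>S\<in>Pow I. real (card {i\<in>I. i \<in> S \<longleftrightarrow> i \<in> Y (f S)}))
    \<le> 2 ^ card I * (card I / 2 + card I * l / 8 + ln K / l)"
proof -
  let ?m = "card I"
  define a where "a S = real (card {i\<in>I. i \<in> S \<longleftrightarrow> i \<in> Y (f S)})" for S
  define B where "B = ?m * l / 2 + ?m * l\<^sup>2 / 8 + ln K"
  have finP: "finite (Pow I)" using assms by simp
  have "card (f ` Pow I) > 0" using finP by (simp add: card_gt_0_iff Pow_not_empty)
  then have "K \<ge> 1" using K by linarith
  \<comment> \<open>Hoeffding's lemma for a fair coin with values 0 and 1: mean 1/2 gives the term
    \<open>l / 2\<close>, range 1 gives \<open>l\<^sup>2 / 8\<close>.\<close>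
  have "(1 + exp l) / 2 \<le> exp (l / 2 + l\<^sup>2 / 8)"
  proof -
    have "- l * (1/2) + ln (1 + 1/2 * (exp l - 1)) \<le> l\<^sup>2 / 8"
      using Hoeffdings_lemma_aux[of l "1/2"] assms by simp
    then have "ln ((1 + exp l) / 2) \<le> l / 2 + l\<^sup>2 / 8" by (simp add: field_simps)
    then show ?thesis by (metis add_pos_pos exp_gt_zero exp_le_cancel_iff exp_ln half_gt_zero zero_less_one)
  qed
  then have step: "(1 + exp l) \<le> 2 * exp (l / 2 + l\<^sup>2 / 8)" by simp
  have pw: "(1 + exp l) ^ ?m \<le> 2 ^ ?m * exp (?m * (l / 2 + l\<^sup>2 / 8))"
  proof -
    have "(1 + exp l) ^ ?m \<le> (2 * exp (l / 2 + l\<^sup>2 / 8)) ^ ?m"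
      using step by (intro power_mono) (auto simp: add_nonneg_nonneg)
    then show ?thesis by (simp add: power_mult_distrib exp_of_nat_mult)
  qed
  have "(\<Sum>S\<in>Pow I. exp (l * a S))
      \<le> (\<Sum>S\<in>Pow I. \<Sum>z\<in>f ` Pow I. exp (l * real (card {i\<in>I. i \<in> S \<longleftrightarrow> i \<in> Y z})))"
  proof (rule sum_mono)
    fix S assume "S \<in> Pow I"
    then have "f S \<in> f ` Pow I" by simp
    then show "exp (l * a S) \<le> (\<Sum>z\<in>f ` Pow I. exp (l * real (card {i\<in>I. i \<in> S \<longleftrightarrow> i \<in> Y z})))"
      unfolding a_def using finP
      by (intro member_le_sum[where f="\<lambda>z. exp (l * real (card {i\<in>I. i \<in> S \<longleftrightarrow> i \<in> Y z}))"]) auto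
  qed
  also have "\<dots> = (\<Sum>z\<in>f ` Pow I. (1 + exp l) ^ ?m)"
    by (subst sum.swap) (simp only: sum_exp_agreement[OF assms(1)])
  also have "\<dots> = real (card (f ` Pow I)) * (1 + exp l) ^ ?m" by simp
  also have "\<dots> \<le> K * (2 ^ ?m * exp (?m * (l / 2 + l\<^sup>2 / 8)))"
    using K pw \<open>K \<ge> 1\<close> by (intro mult_mono) (auto simp: add_nonneg_nonneg)
  also have "\<dots> = 2 ^ ?m * exp B"
    using \<open>K \<ge> 1\<close> by (simp add: B_def exp_add algebra_simps exp_ln)
  finally have tot: "(\<Sum>S\<in>Pow I. exp (l * a S)) \<le> 2 ^ ?m * exp B" .
  \<comment> \<open>Jensen's inequality for \<open>exp\<close>, obtained from its tangent at
    \<open>B\<close>: an average of \<open>exp (l * a S)\<close> of at most \<open>exp B\<close>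
    forces an average of \<open>l * a S\<close> of at most \<open>B\<close>.\<close>
  have "(\<Sum>S\<in>Pow I. l * a S) \<le> (\<Sum>S\<in>Pow I. (B - 1) + exp (- B) * exp (l * a S))"
  proof (rule sum_mono)
    fix S
    have "1 + (l * a S - B) \<le> exp (l * a S - B)" by (rule exp_ge_add_one_self)
    then show "l * a S \<le> (B - 1) + exp (- B) * exp (l * a S)"
      by (simp add: exp_add[symmetric] algebra_simps)
  qed
  also have "\<dots> = 2 ^ ?m * (B - 1) + exp (- B) * (\<Sum>S\<in>Pow I. exp (l * a S))"
    using assms(1) by (simp add: sum.distrib card_Pow sum_distrib_left)
  also have "\<dots> \<le> 2 ^ ?m * (B - 1) + exp (- B) * (2 ^ ?m * exp B)"
    using tot by (intro add_left_mono mult_left_mono) auto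
  also have "\<dots> = 2 ^ ?m * B" by (simp add: exp_minus field_simps)
  finally have "l * (\<Sum>S\<in>Pow I. a S) \<le> 2 ^ ?m * B" by (simp add: sum_distrib_left)
  then have "(\<Sum>S\<in>Pow I. a S) \<le> 2 ^ ?m * B / l" using \<open>l > 0\<close> by (simp add: field_simps)
  also have "\<dots> = 2 ^ ?m * (?m / 2 + ?m * l / 8 + ln K / l)"
    using \<open>l > 0\<close> by (simp add: B_def field_simps power2_eq_square)
  finally show ?thesis unfolding a_def .
qed

section \<open>Memory states as one-way messages\<close>

lemma memory_state_cong:
  assumes "\<And>t. t < n \<Longrightarrow> P t = Q t"
  shows "memory_state A \<omega> P n = memory_state A \<omega> Q n"
  using assms by (induction n) auto

lemma memory_state_cong_after:
  assumes "memory_state A \<omega> P n = memory_state A \<omega> Q n"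
    and "\<And>t. t \<ge> n \<Longrightarrow> P t = Q t" and "t \<ge> n"
  shows "memory_state A \<omega> P t = memory_state A \<omega> Q t"
  using assms(3) by (induction t rule: dec_induct) (auto simp: assms(1,2))

lemma card_bool_lists_length_le: "card {xs :: bool list. length xs \<le> s} \<le> 2 ^ (s + 1)"
proof -
  have "card {xs :: bool list. set xs \<subseteq> UNIV \<and> length xs \<le> s} = (\<Sum>i\<le>s. card (UNIV :: bool set) ^ i)"
    by (rule card_lists_length_le) simp
  also have "\<dots> = (\<Sum>i\<le>s. 2 ^ i)" by simp
  also have "\<dots> \<le> 2 ^ (s + 1)" by (induction s) auto
  finally show ?thesis by simp
qed

text \<open>The reduction with all geometry hidden in \<open>separated\<close>: no single sequence
  of center sets is asymptotically optimal for two streams that share the query \<open>i\<close> but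
  differ in bit \<open>i\<close>. For a fixed seed, equal states after \<open>n\<close> points yield
  equal later outputs, so bit \<open>i\<close> can be decoded from the state wherever the seed
  succeeds.\<close>

lemma index_memory_bound:
  fixes A :: "('r, 'd::finite) streaming_alg"
    and pre :: "nat set \<Rightarrow> nat \<Rightarrow> real ^ 'd" and tl :: "nat \<Rightarrow> nat \<Rightarrow> real ^ 'd"
    and m n :: nat and l \<delta> :: real
    and Q :: "nat set \<Rightarrow> nat \<Rightarrow> nat \<Rightarrow> real ^ 'd"
  assumes Q_def: "\<And>S i t. Q S i t = (if t < n then pre S t else tl i t)"
    and exact: "asymptotically_exact cost k \<delta> X A" and mem: "uses_memory A s"
    and \<delta>: "\<delta> < 1" and l: "l > 0"
    and pre: "\<And>S t. S \<subseteq> {..<m} \<Longrightarrow> t < n \<Longrightarrow>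
        pre S t \<in> integer_points \<and> (\<forall>j. \<bar>pre S t $ j\<bar> \<le> real n)"
    and range: "\<And>S i. S \<subseteq> {..<m} \<Longrightarrow> i < m \<Longrightarrow> range (Q S i) \<subseteq> X"
    and pos: "\<And>S i. S \<subseteq> {..<m} \<Longrightarrow> i < m \<Longrightarrow>
        \<forall>\<^sub>F t in sequentially. opt_cost cost k (Q S i) t > 0"
    and separated: "\<And>S S' i C. \<lbrakk>S \<subseteq> {..<m}; S' \<subseteq> {..<m}; i < m; i \<in> S; i \<notin> S';
        \<And>t. finite (C t) \<and> card (C t) = k;
        (\<lambda>t. cost (Q S i) t (C t) / opt_cost cost k (Q S i) t) \<longlonglongrightarrow> 1;
        (\<lambda>t. cost (Q S' i) t (C t) / opt_cost cost k (Q S' i) t) \<longlonglongrightarrow> 1\<rbrakk> \<Longrightarrow> False"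
  shows "(1 - \<delta>) * m \<le> m / 2 + m * l / 8 + real (s n + 1) / l"
proof -
  interpret prob_space "coins A"
    using exact unfolding asymptotically_exact_def by (rule conjunct1)
  define good where "good S i = {\<omega> \<in> space (coins A).
      (\<lambda>t. cost (Q S i) t (output_centers A \<omega> (Q S i) t) / opt_cost cost k (Q S i) t) \<longlonglongrightarrow> 1}"
    for S i
  let ?I = "{..<m}"
  define V where "V = 2 ^ m * (m / 2 + m * l / 8 + real (s n + 1) / l)"
  have prob: "prob (good S i) \<ge> 1 - \<delta>" if "S \<subseteq> ?I" "i < m" for S i
    unfolding good_def
    by (rule exact[unfolded asymptotically_exact_def, THEN conjunct2, rule_format, THEN conjunct2,
          rule_format, OF range[OF that] pos[OF that]])
  have outs: "finite (output_centers A \<omega> (Q S i) t) \<and> card (output_centers A \<omega> (Q S i) t) = k"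
    if "S \<subseteq> ?I" "i < m" "\<omega> \<in> space (coins A)" for S i \<omega> t
    by (rule exact[unfolded asymptotically_exact_def, THEN conjunct2, rule_format, THEN conjunct1,
          rule_format, OF range[OF that(1,2)] that(3)])
  \<comment> \<open>\<open>measure\<close> is 0 on sets outside the sigma-algebra, so a measure of
    at least \<open>1 - \<delta> > 0\<close> already implies measurability.\<close>
  have meas: "good S i \<in> events" if "S \<subseteq> ?I" "i < m" for S i
    using prob[OF that] \<delta> measure_notin_sets[of "good S i" "coins A"] by force
  define f where "f \<omega> S = memory_state A \<omega> (pre S) n" for \<omega> S
  have f: "memory_state A \<omega> (Q S i) n = f \<omega> S" for \<omega> S i
    unfolding f_def by (rule memory_state_cong) (simp add: Q_def)
  have same: "i \<in> S \<longleftrightarrow> i \<in> S'"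
    if "S \<subseteq> ?I" "S' \<subseteq> ?I" "i < m" "\<omega> \<in> good S i" "\<omega> \<in> good S' i" "f \<omega> S = f \<omega> S'" for S S' i \<omega>
  proof -
    have no: False if S: "S \<subseteq> ?I" "S' \<subseteq> ?I" "i < m" "\<omega> \<in> good S i" "\<omega> \<in> good S' i"
        "f \<omega> S = f \<omega> S'" "i \<in> S" "i \<notin> S'" for S S'
    proof -
      have eq: "output_centers A \<omega> (Q S i) t = output_centers A \<omega> (Q S' i) t" if "t \<ge> n" for t
        unfolding output_centers_def using memory_state_cong_after[of A \<omega> "Q S i" n "Q S' i" t] S(6) that
        by (simp add: f) (simp add: Q_def)
      \<comment> \<open>The outputs on the two streams may differ before time \<open>n\<close>,
        which does not affect the limit. One sequence of outputs therefore serves both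
        streams.\<close>
      have "(\<lambda>t. cost (Q S' i) t (output_centers A \<omega> (Q S i) t) / opt_cost cost k (Q S' i) t) \<longlonglongrightarrow> 1"
        using S(5) unfolding good_def
        by (auto elim!: Lim_transform_eventually intro: eventually_mono[OF eventually_ge_at_top[of n]] simp: eq)
      with S show False
        using separated[of S S' i "output_centers A \<omega> (Q S i)"] outs[of S i \<omega>] by (simp add: good_def)
    qed
    show ?thesis using no[of S S'] no[of S' S] that by metis
  qed
  have bound: "(\<Sum>S\<in>Pow ?I. \<Sum>i\<in>?I. indicator (good S i) \<omega>) \<le> V"
    if short: "\<forall>S\<in>Pow ?I. length (f \<omega> S) \<le> s n" for \<omega>
  proof -
    \<comment> \<open>The decoder: bit \<open>i\<close> is read as set if some encoded set
      containing \<open>i\<close> produces the message \<open>z\<close> with success on query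
      \<open>i\<close>. By \<open>same\<close>, this is correct on every pair where the seed
      succeeds.\<close>
    define Y where "Y z = {i. \<exists>S. S \<subseteq> ?I \<and> f \<omega> S = z \<and> \<omega> \<in> good S i \<and> i \<in> S}" for z
    have "card (f \<omega> ` Pow ?I) \<le> card {xs :: bool list. length xs \<le> s n}"
      using short finite_lists_length_le[of "UNIV :: bool set" "s n"] by (intro card_mono) auto
    then have "card (f \<omega> ` Pow ?I) \<le> 2 ^ (s n + 1)"
      using card_bool_lists_length_le order_trans by blast
    then have K: "real (card (f \<omega> ` Pow ?I)) \<le> 2 ^ (s n + 1)"
      by (metis of_nat_le_iff of_nat_numeral of_nat_power)
    have "(\<Sum>S\<in>Pow ?I. \<Sum>i\<in>?I. indicator (good S i) \<omega>)
        \<le> (\<Sum>S\<in>Pow ?I. real (card {i\<in>?I. i \<in> S \<longleftrightarrow> i \<in> Y (f \<omega> S)}))"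
    proof (rule sum_mono)
      fix S assume S: "S \<in> Pow ?I"
      have "(\<Sum>i\<in>?I. indicator (good S i) \<omega> :: real) = real (card {i\<in>?I. \<omega> \<in> good S i})"
        by (simp add: indicator_def sum.If_cases Int_def)
      also have "\<dots> \<le> real (card {i\<in>?I. i \<in> S \<longleftrightarrow> i \<in> Y (f \<omega> S)})"
      proof (intro of_nat_mono card_mono subsetI)
        fix i assume "i \<in> {i\<in>?I. \<omega> \<in> good S i}"
        then have i: "i < m" "\<omega> \<in> good S i" by simp_all
        have "i \<in> S \<longleftrightarrow> i \<in> Y (f \<omega> S)"
        proof
          assume "i \<in> S"
          then show "i \<in> Y (f \<omega> S)" using S i unfolding Y_def by blast
        next
          assume "i \<in> Y (f \<omega> S)"
          then obtain S' where "S' \<subseteq> ?I" "f \<omega> S' = f \<omega> S" "\<omega> \<in> good S' i" "i \<in> S'"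
            unfolding Y_def by blast
          then show "i \<in> S" using same[of S S' i \<omega>] S i by simp
        qed
        then show "i \<in> {i\<in>?I. i \<in> S \<longleftrightarrow> i \<in> Y (f \<omega> S)}" using i by simp
      qed simp
      finally show "(\<Sum>i\<in>?I. indicator (good S i) \<omega>)
          \<le> real (card {i\<in>?I. i \<in> S \<longleftrightarrow> i \<in> Y (f \<omega> S)})" .
    qed
    also have "\<dots> \<le> 2 ^ m * (m / 2 + m * l / 8 + ln (2 ^ (s n + 1)) / l)"
      using index_agreement_bound[OF _ l K] by simp
    also have "\<dots> \<le> V"
    proof -
      have "ln (2 ^ (s n + 1) :: real) = real (s n + 1) * ln 2"
        by (simp add: ln_realpow del: power_Suc)
      also have "\<dots> \<le> real (s n + 1) * 1"
        using ln_le_minus_one[of "2::real"] by (intro mult_left_mono) auto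
      finally show ?thesis
        unfolding V_def using l by (auto intro!: mult_left_mono add_left_mono divide_right_mono)
    qed
    finally show ?thesis .
  qed
  \<comment> \<open>Each prefix has its own null set of seeds exceeding the memory bound; the union
    over the finitely many sets \<open>S\<close> is still null.\<close>
  have "AE \<omega> in coins A. \<forall>S\<in>Pow ?I. length (f \<omega> S) \<le> s n"
  proof (rule AE_finite_allI)
    fix S assume "S \<in> Pow ?I"
    then show "AE \<omega> in coins A. length (f \<omega> S) \<le> s n"
      using mem pre unfolding uses_memory_def f_def by blast
  qed simp
  then have ae: "AE \<omega> in coins A. (\<Sum>S\<in>Pow ?I. \<Sum>i\<in>?I. indicator (good S i) \<omega>) \<le> V"
    by eventually_elim (rule bound)
  have int: "integrable (coins A) (\<lambda>\<omega>. indicator (good S i) \<omega> :: real)" if "S \<in> Pow ?I" "i \<in> ?I" for S i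
    using meas that by (simp add: emeasure_eq_measure)
  have "2 ^ m * (real m * (1 - \<delta>)) = (\<Sum>S\<in>Pow ?I. \<Sum>i\<in>?I. 1 - \<delta>)" by (simp add: card_Pow)
  also have "\<dots> \<le> (\<Sum>S\<in>Pow ?I. \<Sum>i\<in>?I. prob (good S i))"
    using prob by (intro sum_mono) auto
  also have "\<dots> = (\<integral>\<omega>. (\<Sum>S\<in>Pow ?I. \<Sum>i\<in>?I. indicator (good S i) \<omega>) \<partial>coins A)"
    using int meas by (subst Bochner_Integration.integral_sum; (intro sum.cong Bochner_Integration.integrable_sum refl)?)
      (auto simp: Bochner_Integration.integral_sum)
  also have "\<dots> \<le> (\<integral>\<omega>. V \<partial>coins A)"
    using int ae by (intro integral_mono_AE Bochner_Integration.integrable_sum) auto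
  also have "\<dots> = V" by (simp add: prob_space)
  finally show ?thesis unfolding V_def by (simp add: mult.commute)
qed

section \<open>Streams with recurring points\<close>

definition power_cost :: "nat \<Rightarrow> (nat \<Rightarrow> real ^ 'd) \<Rightarrow> nat \<Rightarrow> (real ^ 'd) set \<Rightarrow> real" where
  "power_cost q P n C = (\<Sum>i<n. infdist (P i) C ^ q)"

lemma kmedian_cost_eq_power_cost: "kmedian_cost = power_cost 1"
  by (intro ext) (simp add: kmedian_cost_def power_cost_def)

lemma kmeans_cost_eq_power_cost: "kmeans_cost = power_cost 2"
  by (intro ext) (simp add: kmeans_cost_def power_cost_def)

lemma power_cost_nonneg: "0 \<le> power_cost q P n C"
  unfolding power_cost_def by (intro sum_nonneg zero_le_power infdist_nonneg)

lemma power_cost_mono: "n \<le> n' \<Longrightarrow> power_cost q P n C \<le> power_cost q P n' C"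
  unfolding power_cost_def by (intro sum_mono2) (auto intro!: zero_le_power infdist_nonneg)

lemma opt_cost_le:
  assumes "finite C" "card C = k"
  shows "opt_cost (power_cost q) k P n \<le> power_cost q P n C"
  unfolding opt_cost_def
  by (rule cINF_lower) (use assms in \<open>auto intro!: bdd_belowI2[where m = 0] power_cost_nonneg\<close>)

lemma le_infdist:
  assumes "A \<noteq> {}" "\<And>a. a \<in> A \<Longrightarrow> r \<le> dist p a"
  shows "r \<le> infdist p A"
  using assms by (simp add: infdist_notempty cINF_greatest)

lemma infdist_finite_attained:
  fixes C :: "'a::heine_borel set"
  assumes "finite C" "C \<noteq> {}"
  obtains c where "c \<in> C" "infdist p C = dist p c"
  using infdist_attains_inf[OF finite_imp_closed[OF assms(1)] assms(2)] by metis

text \<open>Pigeonhole: two of the more than \<open>k\<close> points of \<open>U\<close> share a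
  nearest center, and being at distance at least 1, one of them is at least 1/2 away from it. Since
  the optimum is an infimum, the bound \<open>(1/2) ^ q\<close> has to be uniform in the center
  set.\<close>

lemma opt_cost_eventually_pos:
  fixes P :: "nat \<Rightarrow> real ^ 'd::finite"
  assumes "k > 0" "finite U" "card U > k" "U \<subseteq> range P"
    and sep: "\<And>a b. a \<in> U \<Longrightarrow> b \<in> U \<Longrightarrow> a \<noteq> b \<Longrightarrow> dist a b \<ge> 1"
  shows "\<forall>\<^sub>F n in sequentially. opt_cost (power_cost q) k P n > 0"
proof -
  obtain T where T: "finite T" "U = P ` T"
    using finite_subset_image[OF assms(2,4)] by auto
  obtain M where M: "\<And>t. t \<in> T \<Longrightarrow> t < M"
    using T(1) by (metis finite_nat_set_iff_bounded)
  obtain C0 :: "(real ^ 'd) set" where C0: "finite C0" "card C0 = k"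
    using infinite_arbitrarily_large[of "UNIV :: (real ^ 'd) set" k] infinite_UNIV_char_0
    by (metis infinite_UNIV_vec)
  have "opt_cost (power_cost q) k P n \<ge> (1/2) ^ q" if "n \<ge> M" for n
    unfolding opt_cost_def
  proof (rule cINF_greatest)
    show "{C :: (real ^ 'd) set. finite C \<and> card C = k} \<noteq> {}" using C0 by auto
  next
    fix C :: "(real ^ 'd) set" assume "C \<in> {C. finite C \<and> card C = k}"
    then have C: "finite C" "card C = k" "C \<noteq> {}" using \<open>k > 0\<close> by auto
    define f where "f p = (SOME c. c \<in> C \<and> infdist p C = dist p c)" for p
    have f: "f p \<in> C \<and> infdist p C = dist p (f p)" for p
      unfolding f_def by (rule someI_ex) (use infdist_finite_attained[OF C(1,3)] in metis)
    have "\<not> inj_on f U"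
    proof
      assume "inj_on f U"
      then have "card U \<le> card C" using f C by (intro card_inj_on_le) auto
      then show False using assms C by simp
    qed
    then obtain a b where ab: "a \<in> U" "b \<in> U" "a \<noteq> b" "f a = f b"
      unfolding inj_on_def by blast
    have "1 \<le> dist a b" using sep ab by blast
    also have "\<dots> \<le> dist a (f a) + dist b (f a)" by (rule dist_triangle2)
    also have "\<dots> = infdist a C + infdist b C" using f ab by metis
    finally have "infdist a C \<ge> 1/2 \<or> infdist b C \<ge> 1/2" by linarith
    then obtain u where u: "u \<in> U" "infdist u C \<ge> 1/2" using ab by blast
    then obtain t where t: "t \<in> T" "u = P t" using T by auto
    have "(1/2) ^ q \<le> infdist (P t) C ^ q" using u t by (intro power_mono) auto
    also have "\<dots> \<le> power_cost q P n C"
      unfolding power_cost_def using M[OF t(1)] that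
      by (intro member_le_sum[where f="\<lambda>t. infdist (P t) C ^ q"]) (auto intro!: zero_le_power infdist_nonneg)
    finally show "(1/2) ^ q \<le> power_cost q P n C" .
  qed
  then show ?thesis
    by (intro eventually_mono[OF eventually_ge_at_top[of M]])
      (metis half_gt_zero less_le_trans zero_less_one zero_less_power)
qed

section \<open>Center sets close to the recurring points\<close>

text \<open>Points of \<open>Z\<close> at distance at least 1 cannot share a center closer than
  \<epsilon> to both, so their nearest centers are distinct and exactly one center \<open>c\<close>
  is left over. A point served by any other center is at most \<epsilon> farther from the
  corresponding point of \<open>Z\<close>.\<close>

lemma free_center_exists:
  fixes C Z :: "'a::heine_borel set"
  assumes "finite C" "finite Z" "card C = card Z + 1" "0 < \<epsilon>" "\<epsilon> \<le> 1/2"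
    and sep: "\<And>a b. a \<in> Z \<Longrightarrow> b \<in> Z \<Longrightarrow> a \<noteq> b \<Longrightarrow> dist a b \<ge> 1"
    and near: "\<And>a. a \<in> Z \<Longrightarrow> infdist a C < \<epsilon>"
  obtains c where "\<And>p. infdist p (insert c Z) \<le> infdist p C + \<epsilon>"
proof -
  have "C \<noteq> {}" using assms by auto
  define f where "f p = (SOME c. c \<in> C \<and> infdist p C = dist p c)" for p
  have f: "f p \<in> C \<and> infdist p C = dist p (f p)" for p
    unfolding f_def by (rule someI_ex) (use infdist_finite_attained[OF assms(1) \<open>C \<noteq> {}\<close>] in metis)
  have close: "dist a (f a) < \<epsilon>" if "a \<in> Z" for a using near[OF that] f by metis
  have "inj_on f Z"
  proof (rule inj_onI, rule ccontr)
    fix a b assume ab: "a \<in> Z" "b \<in> Z" "f a = f b" "a \<noteq> b"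
    have "dist a b \<le> dist a (f a) + dist b (f a)" by (rule dist_triangle2)
    also have "\<dots> < 1" using close[OF ab(1)] close[OF ab(2)] ab(3) \<open>\<epsilon> \<le> 1/2\<close> by simp
    finally show False using sep ab by force
  qed
  then have "card (C - f ` Z) = 1"
    using assms f by (subst card_Diff_subset) (auto simp: card_image)
  then obtain c where c: "C - f ` Z = {c}" by (metis card_1_singletonE)
  show thesis
  proof (rule that)
    fix p
    show "infdist p (insert c Z) \<le> infdist p C + \<epsilon>"
    proof (cases "f p = c")
      case True
      then show ?thesis using \<open>0 < \<epsilon>\<close> f[of p] infdist_le[of c "insert c Z" p] by simp
    next
      case False
      then obtain a where a: "a \<in> Z" "f p = f a" using c f[of p] by blast
      have "infdist p (insert c Z) \<le> dist p a" using a by (intro infdist_le) auto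
      also have "\<dots> \<le> dist p (f a) + dist a (f a)" by (rule dist_triangle2)
      also have "\<dots> \<le> infdist p C + \<epsilon>" using close[OF a(1)] f[of p] a by simp
      finally show ?thesis .
    qed
  qed
qed

text \<open>Turns an additive error in distances into one in costs. The distances to
  \<open>insert c Z\<close> are bounded through \<open>Z\<close> alone, so uniform continuity of the
  power on a fixed compact interval gives an \<epsilon> that works for all \<open>c\<close> and
  \<open>C\<close>.\<close>

lemma power_cost_approx:
  fixes P :: "nat \<Rightarrow> real ^ 'd::finite"
  assumes "Z \<noteq> {}" "\<eta> > 0"
  obtains \<epsilon> where "0 < \<epsilon>" "\<epsilon> \<le> 1/2"
    "\<And>c C. (\<And>p. infdist p (insert c Z) \<le> infdist p C + \<epsilon>) \<Longrightarrow>
       power_cost q P N (insert c Z) \<le> power_cost q P N C + \<eta>"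
proof -
  define B where "B = (\<Sum>t<N. infdist (P t) Z)"
  have "uniformly_continuous_on {0..B} (\<lambda>x::real. x ^ q)"
    by (intro compact_uniformly_continuous continuous_intros) auto
  moreover have "\<eta> / (N + 1) > 0" using assms by simp
  ultimately obtain d where d: "d > 0"
    "\<And>x y. x \<in> {0..B} \<Longrightarrow> y \<in> {0..B} \<Longrightarrow> dist y x < d \<Longrightarrow> dist (y ^ q) (x ^ q) < \<eta> / (N + 1)"
    unfolding uniformly_continuous_on_def by metis
  show thesis
  proof (rule that[of "min (1/2) (d/2)"])
    fix c C assume le: "\<And>p. infdist p (insert c Z) \<le> infdist p C + min (1/2) (d/2)"
    have "infdist (P t) (insert c Z) ^ q \<le> infdist (P t) C ^ q + \<eta> / (N + 1)" if "t < N" for t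
    proof -
      let ?r = "infdist (P t) (insert c Z)" and ?u = "infdist (P t) C"
      have r: "0 \<le> ?r" "0 \<le> ?u" by (auto intro: infdist_nonneg)
      show ?thesis
      \<comment> \<open>\<open>?u\<close> has no upper bound in general, but if it exceeds
        \<open>?r\<close>, monotonicity is enough; otherwise both values lie in
        \<open>{0..B}\<close>.\<close>
      proof (cases "?r \<le> ?u")
        case True
        then have "?r ^ q \<le> ?u ^ q" using r by (intro power_mono) auto
        moreover have "\<eta> / (N + 1) > 0" using assms by simp
        ultimately show ?thesis by linarith
      next
        case False
        have "?r \<le> infdist (P t) Z" using assms by (intro infdist_mono) auto
        also have "\<dots> \<le> B"
          unfolding B_def using that
          by (intro member_le_sum[where f="\<lambda>t. infdist (P t) Z"]) (auto intro: infdist_nonneg)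
        finally have "?r \<le> B" .
        moreover have "dist ?r ?u < d" using le[of "P t"] False d(1) by (simp add: dist_real_def)
        ultimately have "dist (?r ^ q) (?u ^ q) < \<eta> / (N + 1)" using False r by (intro d(2)) auto
        then show ?thesis by (simp add: dist_real_def)
      qed
    qed
    then have "power_cost q P N (insert c Z) \<le> (\<Sum>t<N. infdist (P t) C ^ q + \<eta> / (N + 1))"
      unfolding power_cost_def by (intro sum_mono) auto
    also have "\<dots> = power_cost q P N C + N * (\<eta> / (N + 1))"
      by (simp add: sum.distrib power_cost_def)
    also have "\<dots> \<le> power_cost q P N C + \<eta>" using assms by (simp add: field_simps)
    finally show "power_cost q P N (insert c Z) \<le> power_cost q P N C + \<eta>" .
  qed (use d in auto)
qed

text \<open>From time \<open>N\<close> on, \<open>insert z Z\<close> pays nothing more, so the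
  optimum stays bounded and a ratio tending to 1 bounds the cost of \<open>C t\<close> as well.
  Staying \<epsilon> away from a recurring point would cost at least \<open>\<epsilon> ^ q\<close>
  per visit, which eventually exceeds that bound.\<close>

lemma eventually_near_optimal:
  fixes P :: "nat \<Rightarrow> real ^ 'd::finite"
  assumes "q > 0" "finite Z" "card Z + 1 = k" "z \<notin> Z"
    and tl: "\<And>t. t \<ge> N \<Longrightarrow> P t \<in> Z" and inf: "\<And>a. a \<in> Z \<Longrightarrow> infinite {t. P t = a}"
    and pos: "\<forall>\<^sub>F t in sequentially. opt_cost (power_cost q) k P t > 0"
    and lim: "(\<lambda>t. power_cost q P t (C t) / opt_cost (power_cost q) k P t) \<longlonglongrightarrow> 1"
    and "\<eta> > 0" "\<epsilon> > 0"
  shows "\<forall>\<^sub>F t in sequentially. power_cost q P N (C t) < power_cost q P N (insert z Z) + \<eta>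
    \<and> (\<forall>a\<in>Z. infdist a (C t) < \<epsilon>)"
proof -
  define v where "v = power_cost q P N (insert z Z)"
  have "v \<ge> 0" unfolding v_def by (rule power_cost_nonneg)
  have opt: "opt_cost (power_cost q) k P t \<le> v" if "t \<ge> N" for t
  proof -
    have "opt_cost (power_cost q) k P t \<le> power_cost q P t (insert z Z)"
      using assms by (intro opt_cost_le) auto
    also have "\<dots> = v"
      unfolding power_cost_def v_def using that tl \<open>q > 0\<close> by (intro sum.mono_neutral_right) auto
    finally show ?thesis .
  qed
  \<comment> \<open>The denominator \<open>v + 1\<close> instead of \<open>v\<close> avoids a case
    distinction for \<open>v = 0\<close>.\<close>
  have "1 < 1 + \<eta> / (v + 1)" using \<open>\<eta> > 0\<close> \<open>v \<ge> 0\<close> by simp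
  from order_tendstoD(2)[OF lim this] pos eventually_ge_at_top[of N]
  have cost: "\<forall>\<^sub>F t in sequentially. power_cost q P t (C t) < v + \<eta>"
  proof eventually_elim
    case (elim t)
    then have "power_cost q P t (C t) < (1 + \<eta> / (v + 1)) * opt_cost (power_cost q) k P t"
      by (simp add: pos_divide_less_eq)
    also have "\<dots> \<le> (1 + \<eta> / (v + 1)) * v"
      using opt[OF elim(3)] \<open>\<eta> > 0\<close> \<open>v \<ge> 0\<close> by (intro mult_left_mono) auto
    also have "\<dots> \<le> v + \<eta>" using \<open>\<eta> > 0\<close> \<open>v \<ge> 0\<close> by (simp add: field_simps)
    finally show ?case .
  qed
  have "\<forall>\<^sub>F t in sequentially. infdist a (C t) < \<epsilon>" if a: "a \<in> Z" for a
  proof -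
    obtain M :: nat where M: "real M > (v + \<eta>) / \<epsilon> ^ q" using reals_Archimedean2 by blast
    obtain T where T: "finite T" "card T = M" "T \<subseteq> {t. P t = a}"
      using infinite_arbitrarily_large[OF inf[OF a]] by blast
    obtain b where b: "\<And>t. t \<in> T \<Longrightarrow> t < b"
      using T(1) by (metis finite_nat_set_iff_bounded)
    from cost eventually_ge_at_top[of b] show ?thesis
    proof eventually_elim
      case (elim t)
      show ?case
      proof (rule ccontr)
        assume "\<not> infdist a (C t) < \<epsilon>"
        then have "\<epsilon> ^ q \<le> infdist a (C t) ^ q" using \<open>\<epsilon> > 0\<close> by (intro power_mono) auto
        then have "real M * \<epsilon> ^ q \<le> real M * infdist a (C t) ^ q" by (intro mult_left_mono) auto
        also have "\<dots> = (\<Sum>t'\<in>T. infdist (P t') (C t) ^ q)"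
          using T by (simp add: subset_iff)
        also have "\<dots> \<le> power_cost q P t (C t)"
          unfolding power_cost_def using b elim(2)
          by (intro sum_mono2) (auto intro!: zero_le_power infdist_nonneg dest: b)
        also have "\<dots> < v + \<eta>" by (rule elim(1))
        finally show False using M \<open>\<epsilon> > 0\<close> by (simp add: field_simps)
      qed
    qed
  qed
  then have "\<forall>\<^sub>F t in sequentially. \<forall>a\<in>Z. infdist a (C t) < \<epsilon>"
    using \<open>finite Z\<close> by (simp add: eventually_ball_finite)
  with cost eventually_ge_at_top[of N] show ?thesis
  proof eventually_elim
    case (elim t)
    then show ?case using power_cost_mono[of N t q P "C t"] unfolding v_def by auto
  qed
qed

text \<open>\<open>gap\<close> says that no position of the free center is near-optimal for both
  streams. At a late time \<open>C t\<close> is within \<open>\<eta> / 2\<close> of the reference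
  cost on both; replacing it by \<open>insert c Z\<close>, with the same \<open>c\<close> for both,
  loses at most another \<open>\<eta> / 2\<close>.\<close>

lemma near_optimal_separated:
  fixes P P' :: "nat \<Rightarrow> real ^ 'd::finite"
  assumes "q > 0" "finite Z" "Z \<noteq> {}" "card Z + 1 = k" "z \<notin> Z" "z' \<notin> Z" "\<eta> > 0"
    and sep: "\<And>a b. a \<in> Z \<Longrightarrow> b \<in> Z \<Longrightarrow> a \<noteq> b \<Longrightarrow> dist a b \<ge> 1"
    and P: "\<And>t. t \<ge> N \<Longrightarrow> P t \<in> Z" "\<And>a. a \<in> Z \<Longrightarrow> infinite {t. P t = a}"
    and P': "\<And>t. t \<ge> N \<Longrightarrow> P' t \<in> Z" "\<And>a. a \<in> Z \<Longrightarrow> infinite {t. P' t = a}"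
    and pos: "\<forall>\<^sub>F t in sequentially. opt_cost (power_cost q) k P t > 0"
      "\<forall>\<^sub>F t in sequentially. opt_cost (power_cost q) k P' t > 0"
    and gap: "\<And>c. power_cost q P N (insert c Z) \<ge> power_cost q P N (insert z Z) + \<eta>
        \<or> power_cost q P' N (insert c Z) \<ge> power_cost q P' N (insert z' Z) + \<eta>"
    and C: "\<And>t. finite (C t) \<and> card (C t) = k"
    and lim: "(\<lambda>t. power_cost q P t (C t) / opt_cost (power_cost q) k P t) \<longlonglongrightarrow> 1"
      "(\<lambda>t. power_cost q P' t (C t) / opt_cost (power_cost q) k P' t) \<longlonglongrightarrow> 1"
  shows False
proof -
  have "\<eta> / 2 > 0" using \<open>\<eta> > 0\<close> by simp
  obtain \<epsilon>1 where e1: "0 < \<epsilon>1" "\<epsilon>1 \<le> 1/2"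
    "\<And>c C. (\<And>p. infdist p (insert c Z) \<le> infdist p C + \<epsilon>1) \<Longrightarrow>
       power_cost q P N (insert c Z) \<le> power_cost q P N C + \<eta> / 2"
    using power_cost_approx[OF \<open>Z \<noteq> {}\<close> \<open>\<eta> / 2 > 0\<close>] by metis
  obtain \<epsilon>2 where e2: "0 < \<epsilon>2" "\<epsilon>2 \<le> 1/2"
    "\<And>c C. (\<And>p. infdist p (insert c Z) \<le> infdist p C + \<epsilon>2) \<Longrightarrow>
       power_cost q P' N (insert c Z) \<le> power_cost q P' N C + \<eta> / 2"
    using power_cost_approx[OF \<open>Z \<noteq> {}\<close> \<open>\<eta> / 2 > 0\<close>] by metis
  define \<epsilon> where "\<epsilon> = min \<epsilon>1 \<epsilon>2"
  have e: "\<epsilon> > 0" "\<epsilon> \<le> 1/2" "\<epsilon> \<le> \<epsilon>1" "\<epsilon> \<le> \<epsilon>2" using e1 e2 by (auto simp: \<epsilon>_def)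
  have near: "\<forall>\<^sub>F t in sequentially.
      power_cost q P N (C t) < power_cost q P N (insert z Z) + \<eta> / 2 \<and> (\<forall>a\<in>Z. infdist a (C t) < \<epsilon>)"
    by (rule eventually_near_optimal[where k = k]; fact)
  have near': "\<forall>\<^sub>F t in sequentially.
      power_cost q P' N (C t) < power_cost q P' N (insert z' Z) + \<eta> / 2 \<and> (\<forall>a\<in>Z. infdist a (C t) < \<epsilon>)"
    by (rule eventually_near_optimal[where k = k]; fact)
  have "\<forall>\<^sub>F t in sequentially. False"
    using near near'
  proof eventually_elim
    case (elim t)
    obtain c where c: "\<And>p. infdist p (insert c Z) \<le> infdist p (C t) + \<epsilon>"
      using free_center_exists[of "C t" Z \<epsilon>] C[of t] assms(2,4) e(1,2) sep elim by metis
    have "power_cost q P N (insert c Z) \<le> power_cost q P N (C t) + \<eta> / 2"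
      by (rule e1(3)) (meson add_left_mono c e(3) order_trans)
    moreover have "power_cost q P' N (insert c Z) \<le> power_cost q P' N (C t) + \<eta> / 2"
      by (rule e2(3)) (meson add_left_mono c e(4) order_trans)
    ultimately show False using elim gap[of c] by linarith
  qed
  then show False by simp
qed

section \<open>Encoding bits on a line\<close>

text \<open>\<open>undefined\<close> acts as an arbitrary but fixed coordinate index, so the line
  exists in every dimension without a choice of index.\<close>

definition axis_point :: "real \<Rightarrow> real ^ 'd" where
  "axis_point a = axis undefined a"

lemma dist_axis_point [simp]: "dist (axis_point a) (axis_point b :: real ^ 'd::finite) = \<bar>a - b\<bar>"
proof -
  have "axis_point a - axis_point b = (axis_point (a - b) :: real ^ 'd)"
    by (simp add: axis_point_def axis_def vec_eq_iff)
  moreover have "norm (axis_point c :: real ^ 'd) = \<bar>c\<bar>" for c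
    by (simp add: axis_point_def norm_eq_sqrt_inner inner_axis_axis)
  ultimately show ?thesis by (simp add: dist_norm)
qed

lemma axis_point_eq_iff [simp]: "axis_point a = (axis_point b :: real ^ 'd::finite) \<longleftrightarrow> a = b"
  by (metis dist_axis_point abs_eq_0 dist_eq_0_iff right_minus_eq)

text \<open>Projection to the axis does not increase distances to points of the axis. Centers
  anywhere in space can thus be treated through this one coordinate.\<close>

lemma dist_axis_point_ge:
  fixes c :: "real ^ 'd::finite"
  shows "\<bar>a - c $ undefined\<bar> \<le> dist (axis_point a) c"
  using component_le_norm_cart[of "axis_point a - c" undefined]
  by (simp add: axis_point_def dist_norm axis_def)

lemma axis_point_integer: "axis_point (real a) \<in> integer_points"
  by (auto simp: integer_points_def axis_point_def axis_def)

lemma axis_point_component_le: "0 \<le> a \<Longrightarrow> a \<le> b \<Longrightarrow> \<bar>axis_point a $ j\<bar> \<le> b"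
  by (auto simp: axis_point_def axis_def)

text \<open>The spacing 4 leaves room for the shift by a bit and for recurring points between
  neighbors. The padding value 0 differs from all code points, since these start at 4.\<close>

definition code_pos :: "nat \<Rightarrow> nat set \<Rightarrow> nat \<Rightarrow> nat" where
  "code_pos m S t = (if t < m then 4 * (t + 1) + of_bool (t \<in> S) else 0)"

lemma code_pos_le: "4 * m + 1 \<le> n \<Longrightarrow> code_pos m S t \<le> n"
  by (auto simp: code_pos_def)

definition code_stream :: "nat \<Rightarrow> nat \<Rightarrow> nat set \<Rightarrow> (nat \<Rightarrow> nat) \<Rightarrow> nat \<Rightarrow> real ^ 'd" where
  "code_stream n m S \<tau> t = (if t < n then axis_point (code_pos m S t) else axis_point (\<tau> t))"

text \<open>Leaves only \<open>gap\<close> and simple facts about the tail to the two clustering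
  problems. Positivity of the optimum comes from 0, the \<open>i\<close>-th code point and the
  \<open>k - 1\<close> recurring points: \<open>k + 1\<close> distinct integer points on a
  line.\<close>

lemma code_stream_memory_bound:
  fixes A :: "('r, 'd::finite) streaming_alg"
    and \<tau> :: "nat \<Rightarrow> nat \<Rightarrow> nat" and Z :: "nat \<Rightarrow> nat set" and N :: "nat \<Rightarrow> nat" and l \<delta> :: real
    and n m :: nat
  defines "P \<equiv> (\<lambda>S i. code_stream n m S (\<tau> i)) :: nat set \<Rightarrow> nat \<Rightarrow> nat \<Rightarrow> real ^ 'd"
    and "pts \<equiv> (\<lambda>i. (\<lambda>a. axis_point (real a)) ` Z i) :: nat \<Rightarrow> (real ^ 'd) set"
  assumes X: "integer_points \<subseteq> X" and exact: "asymptotically_exact (power_cost q) k \<delta> X A"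
    and mem: "uses_memory A s" and "\<delta> < 1" "l > 0" "q > 0" "k \<ge> 2" and mn: "4 * m + 1 \<le> n"
    and N: "\<And>i. i < m \<Longrightarrow> n \<le> N i"
    and Z: "\<And>i. i < m \<Longrightarrow> finite (Z i)" "\<And>i. i < m \<Longrightarrow> card (Z i) + 1 = k"
      "\<And>i. i < m \<Longrightarrow> Z i \<inter> {0, 4 * (i + 1), 4 * (i + 1) + 1} = {}"
    and \<tau>: "\<And>i t. i < m \<Longrightarrow> t \<ge> N i \<Longrightarrow> \<tau> i t \<in> Z i"
      "\<And>i a. i < m \<Longrightarrow> a \<in> Z i \<Longrightarrow> infinite {t. \<tau> i t = a}"
    and gap: "\<And>S S' i. i < m \<Longrightarrow> i \<in> S \<Longrightarrow> i \<notin> S' \<Longrightarrow>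
      \<exists>\<eta>>0. \<exists>z z'. z \<notin> pts i \<and> z' \<notin> pts i \<and>
        (\<forall>c. power_cost q (P S i) (N i) (insert c (pts i)) \<ge> power_cost q (P S i) (N i) (insert z (pts i)) + \<eta>
          \<or> power_cost q (P S' i) (N i) (insert c (pts i)) \<ge> power_cost q (P S' i) (N i) (insert z' (pts i)) + \<eta>)"
  shows "(1 - \<delta>) * m \<le> m / 2 + m * l / 8 + real (s n + 1) / l"
proof -
  have P_eq: "P S i = (\<lambda>t. if t < n then axis_point (code_pos m S t) else axis_point (\<tau> i t))" for S i
    by (simp add: P_def code_stream_def fun_eq_iff)
  have inj: "inj (\<lambda>a. axis_point (real a) :: real ^ 'd)" by (simp add: inj_def)
  have fin: "finite (pts i)" and card: "card (pts i) + 1 = k" if "i < m" for i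
    using Z(1,2)[OF that] inj by (simp_all add: pts_def card_image inj_on_subset)
  have sep: "dist a b \<ge> 1" if "a \<in> range (\<lambda>a. axis_point (real a) :: real ^ 'd)"
    "b \<in> range (\<lambda>a. axis_point (real a))" "a \<noteq> b" for a b
    using that by auto
  have tail: "P S i t \<in> pts i" if "i < m" "t \<ge> N i" for S i t
    using \<tau>(1)[OF that] N[OF that(1)] that(2) by (auto simp: P_eq pts_def)
  have inf: "infinite {t. P S i t = a}" if i: "i < m" and a: "a \<in> pts i" for S i a
  proof
    obtain b where b: "b \<in> Z i" "a = axis_point (real b)" using a by (auto simp: pts_def)
    assume "finite {t. P S i t = a}"
    then have "finite ({t. P S i t = a} \<union> {..<n})" by simp
    moreover have "{t. \<tau> i t = b} \<subseteq> {t. P S i t = a} \<union> {..<n}" by (auto simp: P_eq b)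
    ultimately show False using \<tau>(2)[OF i b(1)] finite_subset by blast
  qed
  have pos: "\<forall>\<^sub>F t in sequentially. opt_cost (power_cost q) k (P S i) t > 0" if i: "i < m" for S i
  proof (rule opt_cost_eventually_pos)
    let ?U = "insert (axis_point 0) (insert (axis_point (real (code_pos m S i))) (pts i))"
    have mem_pts: "axis_point (real a) \<in> pts i \<longleftrightarrow> a \<in> Z i" for a
      by (simp add: pts_def image_iff)
    have "code_pos m S i \<notin> Z i" "0 \<notin> Z i"
      using Z(3)[OF i] i by (auto simp: code_pos_def)
    then have "axis_point (real (code_pos m S i)) \<notin> pts i" "axis_point 0 \<notin> pts i"
      using mem_pts[of 0] mem_pts by simp_all
    then show "card ?U > k"
      using fin[OF i] card[OF i] i by (simp add: code_pos_def)
    \<comment> \<open>By \<open>mn\<close> the index \<open>m\<close> still belongs to the prefix,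
      where it is the first padding point.\<close>
    have "axis_point 0 = P S i m" "axis_point (real (code_pos m S i)) = P S i i"
      using mn i by (simp_all add: P_eq code_pos_def)
    moreover have "pts i \<subseteq> range (P S i)"
    proof
      fix a assume "a \<in> pts i"
      then obtain t where "P S i t = a" using inf[OF i, of a S] not_finite_existsD by blast
      then show "a \<in> range (P S i)" by blast
    qed
    ultimately show "?U \<subseteq> range (P S i)" by blast
    have U: "?U \<subseteq> range (\<lambda>a. axis_point (real a))"
      using rangeI[of "\<lambda>a. axis_point (real a)" 0] by (auto simp: pts_def)
    show "dist a b \<ge> 1" if "a \<in> ?U" "b \<in> ?U" "a \<noteq> b" for a b
      by (rule sep[OF subsetD[OF U that(1)] subsetD[OF U that(2)] that(3)])
    show "finite ?U" "k > 0" using fin[OF i] \<open>k \<ge> 2\<close> by auto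
  qed
  show ?thesis
  proof (rule index_memory_bound[where Q = P, OF _ exact mem \<open>\<delta> < 1\<close> \<open>l > 0\<close>])
    fix S i t
    show "P S i t = (if t < n then axis_point (code_pos m S t) else axis_point (\<tau> i t))"
      by (simp add: P_eq)
  next
    fix S t
    show "axis_point (code_pos m S t) \<in> integer_points \<and>
        (\<forall>j. \<bar>(axis_point (code_pos m S t) :: real ^ 'd) $ j\<bar> \<le> real n)"
      using code_pos_le[OF mn, of S t] by (simp add: axis_point_integer axis_point_component_le)
  next
    fix S i
    show "range (P S i) \<subseteq> X" using X axis_point_integer by (auto simp: P_eq)
  next
    fix S i assume "i < m"
    then show "\<forall>\<^sub>F t in sequentially. opt_cost (power_cost q) k (P S i) t > 0" by (rule pos)
  next
    fix S S' :: "nat set" and i and C :: "nat \<Rightarrow> (real ^ 'd) set"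
    assume i: "i < m" "i \<in> S" "i \<notin> S'"
      and C: "\<And>t. finite (C t) \<and> card (C t) = k"
      and lim: "(\<lambda>t. power_cost q (P S i) t (C t) / opt_cost (power_cost q) k (P S i) t) \<longlonglongrightarrow> 1"
        "(\<lambda>t. power_cost q (P S' i) t (C t) / opt_cost (power_cost q) k (P S' i) t) \<longlonglongrightarrow> 1"
    obtain \<eta> z z' where g: "\<eta> > 0" "z \<notin> pts i" "z' \<notin> pts i"
      "\<And>c. power_cost q (P S i) (N i) (insert c (pts i)) \<ge> power_cost q (P S i) (N i) (insert z (pts i)) + \<eta>
          \<or> power_cost q (P S' i) (N i) (insert c (pts i)) \<ge> power_cost q (P S' i) (N i) (insert z' (pts i)) + \<eta>"
      using gap[OF i] by blast
    have "pts i \<noteq> {}" using card[OF i(1)] \<open>k \<ge> 2\<close> by auto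
    then show False
      using near_optimal_separated[OF \<open>q > 0\<close> fin[OF i(1)] _ card[OF i(1)] g(2,3,1) _
          tail[OF i(1)] inf[OF i(1)] tail[OF i(1)] inf[OF i(1)] pos[OF i(1)] pos[OF i(1)] g(4) C lim]
        sep by (auto simp: pts_def)
  qed
qed

section \<open>Tails repeating finitely many points\<close>

definition cyclic_tail :: "nat \<Rightarrow> (nat \<Rightarrow> nat) \<Rightarrow> (nat \<Rightarrow> nat) \<Rightarrow> nat \<Rightarrow> nat \<Rightarrow> nat" where
  "cyclic_tail N h \<alpha> r t = (if t < N then h t else \<alpha> (t mod r))"

lemma cyclic_tail_mem: "r > 0 \<Longrightarrow> t \<ge> N \<Longrightarrow> cyclic_tail N h \<alpha> r t \<in> \<alpha> ` {..<r}"
  by (auto simp: cyclic_tail_def)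

lemma cyclic_tail_recurs:
  assumes "a \<in> \<alpha> ` {..<r}"
  shows "infinite {t. cyclic_tail N h \<alpha> r t = a}"
proof -
  obtain j where j: "j < r" "a = \<alpha> j" using assms by auto
  have "\<exists>t\<ge>b. t \<in> {t. cyclic_tail N h \<alpha> r t = a}" for b
  proof (intro exI conjI)
    \<comment> \<open>The witness has residue \<open>j\<close> modulo \<open>r\<close> and lies
      beyond both \<open>b\<close> and \<open>N\<close>, because \<open>j < r\<close> gives
      \<open>r > 0\<close>.\<close>
    have ge: "r * (b + N) + j \<ge> b + N" using j(1) by (cases r) auto
    then show "r * (b + N) + j \<ge> b" by linarith
    show "r * (b + N) + j \<in> {t. cyclic_tail N h \<alpha> r t = a}"
      using ge j by (simp add: cyclic_tail_def)
  qed
  then show ?thesis by (auto simp: infinite_nat_iff_unbounded_le)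
qed

lemma sum_lessThan_add:
  fixes g :: "nat \<Rightarrow> 'a::comm_monoid_add"
  shows "(\<Sum>t<a + b. g t) = (\<Sum>t<a. g t) + (\<Sum>t<b. g (a + t))"
  by (induction b) (auto simp: add.assoc)

section \<open>Queries\<close>

text \<open>The partner of prefix point \<open>t\<close> arrives at time \<open>n + t\<close>: 0 for
  code points to the right of the \<open>i\<close>-th, \<open>n\<close> for those to the left and
  for padding. The \<open>i\<close>-th one is matched with the recurring point
  \<open>2 * n + 1\<close>, which costs nothing.\<close>

definition median_query :: "nat \<Rightarrow> nat \<Rightarrow> nat \<Rightarrow> nat \<Rightarrow> nat" where
  "median_query n m i t =
     (if t = n + i then 2 * n + 1 else if n + i < t \<and> t < n + m then 0 else n)"

definition median_tail :: "nat \<Rightarrow> nat \<Rightarrow> nat \<Rightarrow> nat \<Rightarrow> nat \<Rightarrow> nat" where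
  "median_tail n m r i = cyclic_tail (2 * n) (median_query n m i) (\<lambda>j. 2 * n + 1 + j) r"

text \<open>The query pairs every prefix point except the \<open>i\<close>-th with a point on the other side of
  the \<open>i\<close>-th one. A pair costs at least the distance of its two points, and exactly that if the free
  center is the \<open>i\<close>-th point.\<close>

lemma median_gap:
  fixes c :: "real ^ 'd::finite" and n m i r :: nat
  defines "P \<equiv> (\<lambda>S. code_stream n m S (median_tail n m r i)) :: nat set \<Rightarrow> nat \<Rightarrow> real ^ 'd"
    and "pts \<equiv> (\<lambda>a. axis_point (real a) :: real ^ 'd) ` (\<lambda>j. 2 * n + 1 + j) ` {..<r}"
    and "z \<equiv> (\<lambda>S. axis_point (code_pos m S i)) :: nat set \<Rightarrow> real ^ 'd"
  assumes "i < m" "r > 0" and mn: "4 * m + 1 \<le> n"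
  shows "power_cost 1 (P S) (2 * n) (insert c pts) \<ge>
    power_cost 1 (P S) (2 * n) (insert (z S) pts) + min \<bar>real (code_pos m S i) - c $ undefined\<bar> 1"
proof -
  define p where "p t = real (code_pos m S t)" for t
  define h where "h t = real (median_query n m i (n + t))" for t
  define J where "J C a = infdist (axis_point a) C" for C :: "(real ^ 'd) set" and a
  have "i < n" using assms by simp
  have cost: "power_cost 1 (P S) (2 * n) C
      = (\<Sum>t\<in>{..<n} - {i}. J C (p t) + J C (h t)) + (J C (p i) + J C (h i))" for C
  proof -
    have "power_cost 1 (P S) (2 * n) C = (\<Sum>t<n + n. infdist (P S t) C)"
      by (simp add: power_cost_def mult_2)
    also have "\<dots> = (\<Sum>t<n. J C (p t)) + (\<Sum>t<n. J C (h t))"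
      by (simp add: sum_lessThan_add P_def code_stream_def J_def p_def h_def median_tail_def
          cyclic_tail_def)
    also have "\<dots> = (\<Sum>t<n. J C (p t) + J C (h t))" by (simp add: sum.distrib)
    finally show ?thesis using \<open>i < n\<close> by (simp add: sum.remove[of _ i] add.commute)
  qed
  have p: "0 \<le> p t" "p t \<le> n" for t using code_pos_le[OF mn] by (simp_all add: p_def)
  have h: "0 \<le> h t" "h t \<le> n" if "t \<noteq> i" for t using that by (simp_all add: h_def median_query_def)
  have fin: "finite (insert c pts)" by (simp add: pts_def)
  \<comment> \<open>Starting the recurring points at \<open>2 * n + 1\<close> makes serving a point
    of \<open>{0..n}\<close> by one of them cost more than \<open>n\<close>, hence more than the
    distance of any pair.\<close>
  have far: "dist (axis_point a) y \<ge> real n + 1" if "y \<in> pts" "a \<le> real n" for a y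
    using that by (auto simp: pts_def)
  have pair: "J (insert c pts) (p t) + J (insert c pts) (h t) \<ge> \<bar>p t - h t\<bar>" if t: "t \<noteq> i" for t
  proof -
    obtain y where y: "y \<in> insert c pts" "J (insert c pts) (p t) = dist (axis_point (p t)) y"
      unfolding J_def using infdist_finite_attained[OF fin] by blast
    obtain y' where y': "y' \<in> insert c pts" "J (insert c pts) (h t) = dist (axis_point (h t)) y'"
      unfolding J_def using infdist_finite_attained[OF fin] by blast
    show ?thesis
    proof (cases "y = c \<and> y' = c")
      case True
      then show ?thesis
        using dist_triangle2[of "axis_point (p t)" "axis_point (h t)" c] y y' by simp
    next
      case False
      then have "dist (axis_point (p t)) y \<ge> real n + 1 \<or> dist (axis_point (h t)) y' \<ge> real n + 1"
        using far[of y "p t"] far[of y' "h t"] p[of t] h[OF t] y y' by auto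
      moreover have "\<bar>p t - h t\<bar> \<le> n" using p[of t] h[OF t] by linarith
      ultimately show ?thesis
        using y(2) y'(2) zero_le_dist[of "axis_point (p t)" y] zero_le_dist[of "axis_point (h t)" y'] by linarith
    qed
  qed
  have "J (insert c pts) (p i) \<ge> min \<bar>p i - c $ undefined\<bar> 1"
    unfolding J_def
  proof (rule le_infdist)
    fix y assume "y \<in> insert c pts"
    then show "min \<bar>p i - c $ undefined\<bar> 1 \<le> dist (axis_point (p i)) y"
      using far[of y "p i"] p[of i] dist_axis_point_ge[of "p i" c] by fastforce
  qed simp
  moreover have "J (insert c pts) (h i) \<ge> 0" unfolding J_def by (rule infdist_nonneg)
  moreover have "(\<Sum>t\<in>{..<n} - {i}. J (insert c pts) (p t) + J (insert c pts) (h t))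
      \<ge> (\<Sum>t\<in>{..<n} - {i}. \<bar>p t - h t\<bar>)"
    using pair by (intro sum_mono) auto
  ultimately have lower: "power_cost 1 (P S) (2 * n) (insert c pts)
      \<ge> (\<Sum>t\<in>{..<n} - {i}. \<bar>p t - h t\<bar>) + min \<bar>p i - c $ undefined\<bar> 1"
    unfolding cost by linarith
  have "J (insert (z S) pts) (p t) + J (insert (z S) pts) (h t) \<le> \<bar>p t - h t\<bar>" if t: "t \<noteq> i" for t
  proof -
    have "J (insert (z S) pts) a \<le> \<bar>a - p i\<bar>" for a
      using infdist_le[of "z S" "insert (z S) pts" "axis_point a"] by (simp add: J_def z_def p_def)
    \<comment> \<open>The \<open>i\<close>-th point lies between the two points of the pair, so the
      triangle inequality is an equality there.\<close>
    moreover have "\<bar>p t - h t\<bar> = \<bar>p t - p i\<bar> + \<bar>h t - p i\<bar>"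
    proof (cases "i < t \<and> t < m")
      case True
      then show ?thesis using \<open>i < m\<close> by (simp add: p_def h_def code_pos_def median_query_def)
    next
      case False
      then have "p t \<le> p i" using t \<open>i < m\<close> by (auto simp: p_def code_pos_def)
      moreover have "h t = n" using False t by (auto simp: h_def median_query_def)
      ultimately show ?thesis using p[of i] by linarith
    qed
    ultimately show ?thesis by (metis add_mono)
  qed
  then have "(\<Sum>t\<in>{..<n} - {i}. J (insert (z S) pts) (p t) + J (insert (z S) pts) (h t))
      \<le> (\<Sum>t\<in>{..<n} - {i}. \<bar>p t - h t\<bar>)"
    by (intro sum_mono) auto
  moreover have "J (insert (z S) pts) (p i) = 0" by (simp add: J_def z_def p_def)
  moreover have "J (insert (z S) pts) (h i) = 0"
  proof -
    have "axis_point (h i) \<in> pts"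
      using \<open>r > 0\<close> by (auto simp: pts_def h_def median_query_def image_image intro!: image_eqI[of _ _ 0])
    then show ?thesis by (simp add: J_def)
  qed
  ultimately show ?thesis using lower unfolding cost[of "insert (z S) pts"] by (simp add: p_def)
qed

section \<open>The query for k-means\<close>

text \<open>A quarter of this number is \<open>n ^ 3 + 2\<close>. This covers the cost
  \<open>n ^ 3\<close> of the other prefix points, the cost of at most 1 around the optimal free
  center, and the required gap of at most 1.\<close>

definition means_copies :: "nat \<Rightarrow> nat" where
  "means_copies n = 4 * n ^ 3 + 8"

text \<open>With \<open>b = 4 * (i + 1)\<close>, the first two values are \<open>b - 2\<close> and
  \<open>b + 3\<close>; further ones continue to the right. They shield the free center near
  \<open>b\<close> from the other prefix points on both sides, which takes two fixed centers and
  hence \<open>k \<ge> 3\<close>.\<close>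

definition means_anchor :: "nat \<Rightarrow> nat \<Rightarrow> nat" where
  "means_anchor i j = (if j = 0 then 4 * i + 2 else 4 * i + 6 + j)"

definition means_tail :: "nat \<Rightarrow> nat \<Rightarrow> nat \<Rightarrow> nat \<Rightarrow> nat" where
  "means_tail n r i = cyclic_tail (n + means_copies n) (\<lambda>_. 4 * (i + 1)) (means_anchor i) r"

text \<open>The query puts so many points at \<open>b = 4 * (i + 1)\<close> that the free center must be close to \<open>b\<close>,
  where it serves them and the \<open>i\<close>-th prefix point, but no other point. Its optimal position is
  thus the mean of these points, which is \<open>b\<close> or \<open>b + 1 / (W + 1)\<close> for \<open>W\<close> copies of \<open>b\<close>.\<close>

lemma means_gap:
  fixes c :: "real ^ 'd::finite" and n m i r :: nat
  defines "P \<equiv> (\<lambda>S. code_stream n m S (means_tail n r i)) :: nat set \<Rightarrow> nat \<Rightarrow> real ^ 'd"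
    and "pts \<equiv> (\<lambda>a. axis_point (real a) :: real ^ 'd) ` means_anchor i ` {..<r}"
    and "W \<equiv> real (means_copies n)"
    and "opt \<equiv> (\<lambda>S. 4 * (real i + 1) + of_bool (i \<in> S) / (real (means_copies n) + 1))"
  assumes "i < m" "r \<ge> 2" and mn: "4 * m + 1 \<le> n"
  shows "power_cost 2 (P S) (n + means_copies n) (insert c pts) \<ge>
      power_cost 2 (P S) (n + means_copies n) (insert (axis_point (opt S)) pts)
        + min ((W + 1) * (c $ undefined - opt S)\<^sup>2) 1"
proof -
  define p where "p t = real (code_pos m S t)" for t
  define b where "b = 4 * (real i + 1)"
  define x where "x = (of_bool (i \<in> S) :: real)"
  define J where "J C a = infdist (axis_point a) C" for C :: "(real ^ 'd) set" and a
  define F where "F = (\<Sum>t\<in>{..<n} - {i}. (J pts (p t))\<^sup>2)"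
  have "i < n" using assms by simp
  have W: "W = 4 * real n ^ 3 + 8" by (simp add: W_def means_copies_def)
  then have "W \<ge> 0" by (simp add: add_nonneg_nonneg)
  then have "W + 1 > 0" by linarith
  have x: "x = 0 \<or> x = 1" by (simp add: x_def)
  have opt: "opt S = b + x / (W + 1)" by (simp add: opt_def b_def x_def W_def)
  have cost: "power_cost 2 (P S) (n + means_copies n) C
      = (\<Sum>t\<in>{..<n} - {i}. (J C (p t))\<^sup>2) + (J C (p i))\<^sup>2 + W * (J C b)\<^sup>2" for C
  proof -
    have "power_cost 2 (P S) (n + means_copies n) C = (\<Sum>t<n. (J C (p t))\<^sup>2) + W * (J C b)\<^sup>2"
      by (simp add: power_cost_def sum_lessThan_add P_def code_stream_def J_def p_def b_def
          means_tail_def cyclic_tail_def W_def add.commute)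
    then show ?thesis using \<open>i < n\<close> by (simp add: sum.remove[of _ i] add.commute)
  qed
  have J_nonneg: "J C a \<ge> 0" for C a unfolding J_def by (rule infdist_nonneg)
  have pi: "p i = b + x" using \<open>i < m\<close> by (simp add: p_def b_def x_def code_pos_def)
  have left: "axis_point (b - 2) \<in> pts"
    using \<open>r \<ge> 2\<close> by (auto simp: pts_def image_image means_anchor_def b_def intro!: image_eqI[of _ _ 0])
  have right: "axis_point (b + 3) \<in> pts"
    using \<open>r \<ge> 2\<close> by (auto simp: pts_def image_image means_anchor_def b_def intro!: image_eqI[of _ _ 1])
  have far: "a \<le> b - 2 \<or> a \<ge> b + 3" if "axis_point a \<in> pts" for a
    using that by (auto simp: pts_def means_anchor_def b_def split: if_splits)
  have pts: "pts \<noteq> {}" "pts \<subseteq> range axis_point" using left by (auto simp: pts_def)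
  have "F \<le> real n ^ 3"
  proof -
    have "F \<le> (\<Sum>t\<in>{..<n} - {i}. (real n)\<^sup>2)"
      unfolding F_def
    proof (intro sum_mono power_mono J_nonneg)
      fix t
      have "J pts (p t) \<le> \<bar>p t - (b - 2)\<bar>"
        using infdist_le[OF left, of "axis_point (p t)"] by (simp add: J_def)
      moreover have "0 \<le> p t" "p t \<le> n" using code_pos_le[OF mn] by (simp_all add: p_def)
      moreover have "b - 2 \<le> n" "b - 2 \<ge> 0" using \<open>i < m\<close> mn by (simp_all add: b_def)
      ultimately show "J pts (p t) \<le> real n" by linarith
    qed
    also have "\<dots> \<le> real n * (real n)\<^sup>2"
      using \<open>i < n\<close> by (simp add: card_Diff_singleton_if mult_right_mono)
    finally show ?thesis by (simp add: power3_eq_cube power2_eq_square)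
  qed
  have upper: "power_cost 2 (P S) (n + means_copies n) (insert (axis_point (opt S)) pts)
      \<le> F + x * W / (W + 1)"
  proof -
    let ?C = "insert (axis_point (opt S)) pts :: (real ^ 'd) set"
    have "(\<Sum>t\<in>{..<n} - {i}. (J ?C (p t))\<^sup>2) \<le> F"
      unfolding F_def
      by (intro sum_mono power_mono J_nonneg) (auto simp: J_def intro!: infdist_mono pts)
    moreover have le: "J ?C a \<le> \<bar>a - opt S\<bar>" for a
      using infdist_le[of "axis_point (opt S)" ?C "axis_point a"] by (simp add: J_def)
    have "(J ?C a)\<^sup>2 \<le> (a - opt S)\<^sup>2" for a
      using power_mono[OF le[of a] J_nonneg, of 2] by simp
    then have "(J ?C (p i))\<^sup>2 + W * (J ?C b)\<^sup>2 \<le> (p i - opt S)\<^sup>2 + W * (b - opt S)\<^sup>2"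
      using \<open>W \<ge> 0\<close> by (intro add_mono mult_left_mono) auto
    moreover have "(p i - opt S)\<^sup>2 + W * (b - opt S)\<^sup>2 = x * W / (W + 1)"
    proof -
      have "(1 - 1 / (W + 1))\<^sup>2 + W * (1 / (W + 1))\<^sup>2 = W / (W + 1)"
        using \<open>W + 1 > 0\<close> by (simp add: power2_eq_square divide_simps) (simp add: algebra_simps)
      then show ?thesis using x by (auto simp: opt pi power2_eq_square)
    qed
    ultimately show ?thesis unfolding cost by linarith
  qed
  show ?thesis
  \<comment> \<open>If \<open>c\<close> is at least 1/2 away from \<open>b\<close>, then so is every
    center, and the copies of \<open>b\<close> alone cost at least \<open>W / 4\<close>.\<close>
  proof (cases "dist (axis_point b) c < 1/2")
    case False
    have "1/2 \<le> J (insert c pts) b"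
      unfolding J_def
    proof (rule le_infdist)
      fix y assume "y \<in> insert c pts"
      then show "1/2 \<le> dist (axis_point b) y"
      proof
        assume "y \<in> pts"
        then obtain a where "y = axis_point a" "axis_point a \<in> pts" using pts(2) by auto
        then show ?thesis using far[of a] by auto
      qed (use False in simp)
    qed simp
    then have "(1/2)\<^sup>2 \<le> (J (insert c pts) b)\<^sup>2" by (intro power_mono) auto
    then have "W * (1/2)\<^sup>2 \<le> W * (J (insert c pts) b)\<^sup>2" using \<open>W \<ge> 0\<close> by (intro mult_left_mono) auto
    also have "\<dots> \<le> power_cost 2 (P S) (n + means_copies n) (insert c pts)"
      unfolding cost using \<open>W \<ge> 0\<close> by (simp add: sum_nonneg)
    finally have "real n ^ 3 + 2 \<le> power_cost 2 (P S) (n + means_copies n) (insert c pts)"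
      using W by (simp add: power2_eq_square)
    moreover have "x * W / (W + 1) \<le> 1" using x \<open>W \<ge> 0\<close> by (auto simp: divide_simps)
    ultimately show ?thesis using upper \<open>F \<le> real n ^ 3\<close> by linarith
  next
    case True
    define y where "y = c $ undefined - b"
    have y: "\<bar>y\<bar> < 1/2" using True dist_axis_point_ge[of b c] unfolding y_def by linarith
    have "J (insert c pts) (p t) \<ge> J pts (p t)" if t: "t \<noteq> i" for t
      unfolding J_def
    proof (rule le_infdist)
      fix u assume "u \<in> insert c pts"
      then show "infdist (axis_point (p t)) pts \<le> dist (axis_point (p t)) u"
      proof
        assume "u = c"
        \<comment> \<open>All other prefix points lie beyond \<open>b - 2\<close> or
          \<open>b + 3\<close>, so one of these two anchors is nearer to them than a center within
          1/2 of \<open>b\<close>.\<close>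
        have "p t \<le> b - 3 \<or> p t \<ge> b + 4"
          using t \<open>i < m\<close> by (cases "t < i") (auto simp: p_def b_def code_pos_def)
        moreover have "infdist (axis_point (p t)) pts \<le> \<bar>p t - (b - 2)\<bar>"
          "infdist (axis_point (p t)) pts \<le> \<bar>p t - (b + 3)\<bar>"
          using infdist_le[OF left, of "axis_point (p t)"] infdist_le[OF right, of "axis_point (p t)"]
          by simp_all
        moreover have "\<bar>p t - b - y\<bar> \<le> dist (axis_point (p t)) u"
          using dist_axis_point_ge[of "p t" c] \<open>u = c\<close> by (simp add: y_def)
        ultimately show ?thesis using y by linarith
      qed (rule infdist_le)
    qed simp
    then have "F \<le> (\<Sum>t\<in>{..<n} - {i}. (J (insert c pts) (p t))\<^sup>2)"
      unfolding F_def by (intro sum_mono power_mono J_nonneg) auto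
    moreover have near: "J (insert c pts) a \<ge> \<bar>a - b - y\<bar>" if "a = b \<or> a = b + x" for a
      unfolding J_def
    proof (rule le_infdist)
      fix u assume "u \<in> insert c pts"
      then show "\<bar>a - b - y\<bar> \<le> dist (axis_point a) u"
      proof
        assume "u \<in> pts"
        then obtain a' where "u = axis_point a'" "axis_point a' \<in> pts" using pts(2) by auto
        then show ?thesis using far[of a'] that x y by auto
      qed (use dist_axis_point_ge[of a c] in \<open>simp add: y_def\<close>)
    qed simp
    have "(x - y)\<^sup>2 \<le> (J (insert c pts) (p i))\<^sup>2" "y\<^sup>2 \<le> (J (insert c pts) b)\<^sup>2"
      using near[of "p i"] near[of b] power_mono[of "\<bar>x - y\<bar>" _ 2] power_mono[of "\<bar>y\<bar>" _ 2]
      by (simp_all add: pi)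
    moreover from this(2) have "W * y\<^sup>2 \<le> W * (J (insert c pts) b)\<^sup>2"
      using \<open>W \<ge> 0\<close> by (intro mult_left_mono) auto
    \<comment> \<open>Completing the square: the total squared distance to a position is the minimum
      plus the number of points times the squared distance to their mean.\<close>
    moreover have "(x - y)\<^sup>2 + W * y\<^sup>2 = x * W / (W + 1) + (W + 1) * (c $ undefined - opt S)\<^sup>2"
    proof -
      have "(1 - y)\<^sup>2 + W * y\<^sup>2 = W / (W + 1) + (W + 1) * (y - 1 / (W + 1))\<^sup>2"
        using \<open>W + 1 > 0\<close> by (simp add: power2_eq_square divide_simps) (simp add: algebra_simps)
      then show ?thesis using x by (auto simp: opt y_def algebra_simps power2_eq_square)
    qed
    ultimately show ?thesis using upper unfolding cost[of "insert c pts"] by linarith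
  qed
qed

section \<open>The lower bound\<close>

lemma median_memory_bound:
  fixes A :: "('r, 'd::finite) streaming_alg" and m n :: nat and l \<delta> :: real
  assumes "integer_points \<subseteq> X" "asymptotically_exact kmedian_cost k \<delta> X A" "uses_memory A s"
    and "\<delta> < 1" "l > 0" "k \<ge> 2" "4 * m + 1 \<le> n"
  shows "(1 - \<delta>) * m \<le> m / 2 + m * l / 8 + real (s n + 1) / l"
proof (rule code_stream_memory_bound[OF assms(1) assms(2)[unfolded kmedian_cost_eq_power_cost] assms(3-5),
      where N = "\<lambda>_. 2 * n"
      and Z = "\<lambda>_. (\<lambda>j. 2 * n + 1 + j) ` {..<k - 1}" and \<tau> = "median_tail n m (k - 1)"])
  show "card ((\<lambda>j. 2 * n + 1 + j) ` {..<k - 1}) + 1 = k"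
    using \<open>k \<ge> 2\<close> by (simp add: card_image inj_on_def)
  have "k - 1 > 0" using \<open>k \<ge> 2\<close> by simp
  fix i assume i: "i < m"
  show "(\<lambda>j. 2 * n + 1 + j) ` {..<k - 1} \<inter> {0, 4 * (i + 1), 4 * (i + 1) + 1} = {}"
    using i assms(7) by auto
  show "median_tail n m (k - 1) i t \<in> (\<lambda>j. 2 * n + 1 + j) ` {..<k - 1}" if "t \<ge> 2 * n" for t
    unfolding median_tail_def by (rule cyclic_tail_mem[OF \<open>k - 1 > 0\<close> that])
  show "infinite {t. median_tail n m (k - 1) i t = a}"
    if "a \<in> (\<lambda>j. 2 * n + 1 + j) ` {..<k - 1}" for a
    unfolding median_tail_def by (rule cyclic_tail_recurs[OF that])
  fix S S' assume S: "i \<in> S" "i \<notin> S'"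
  let ?pts = "(\<lambda>a. axis_point (real a) :: real ^ 'd) ` (\<lambda>j. 2 * n + 1 + j) ` {..<k - 1}"
  let ?P = "\<lambda>S. code_stream n m S (median_tail n m (k - 1) i) :: nat \<Rightarrow> real ^ 'd"
  let ?z = "\<lambda>S. axis_point (code_pos m S i) :: real ^ 'd"
  have "?z T \<notin> ?pts" for T
    using code_pos_le[OF assms(7), of T i] by auto
  \<comment> \<open>The \<open>i\<close>-th points of the two prefixes are 1 apart, so
    \<open>c\<close> misses one of them by at least 1/2.\<close>
  moreover have "power_cost 1 (?P S) (2 * n) (insert c ?pts) \<ge> power_cost 1 (?P S) (2 * n) (insert (?z S) ?pts) + 1/2
      \<or> power_cost 1 (?P S') (2 * n) (insert c ?pts) \<ge> power_cost 1 (?P S') (2 * n) (insert (?z S') ?pts) + 1/2" for c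
  proof -
    have "real (code_pos m S i) = real (code_pos m S' i) + 1" using S i by (simp add: code_pos_def)
    then have "min \<bar>real (code_pos m S i) - c $ undefined\<bar> 1 \<ge> 1/2
        \<or> min \<bar>real (code_pos m S' i) - c $ undefined\<bar> 1 \<ge> 1/2" by linarith
    then show ?thesis
      using median_gap[OF i \<open>k - 1 > 0\<close> assms(7), of S c] median_gap[OF i \<open>k - 1 > 0\<close> assms(7), of S' c]
      by linarith
  qed
  ultimately show "\<exists>\<eta>>0. \<exists>z z'. z \<notin> ?pts \<and> z' \<notin> ?pts \<and>
     (\<forall>c. power_cost 1 (?P S) (2 * n) (insert c ?pts) \<ge> power_cost 1 (?P S) (2 * n) (insert z ?pts) + \<eta>
      \<or> power_cost 1 (?P S') (2 * n) (insert c ?pts) \<ge> power_cost 1 (?P S') (2 * n) (insert z' ?pts) + \<eta>)"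
    by (intro exI[of _ "1/2"] exI[of _ "?z S"] exI[of _ "?z S'"] conjI allI) simp_all
qed (use assms in auto)

lemma means_memory_bound:
  fixes A :: "('r, 'd::finite) streaming_alg" and m n :: nat and l \<delta> :: real
  assumes "integer_points \<subseteq> X" "asymptotically_exact kmeans_cost k \<delta> X A" "uses_memory A s"
    and "\<delta> < 1" "l > 0" "k \<ge> 3" "4 * m + 1 \<le> n"
  shows "(1 - \<delta>) * m \<le> m / 2 + m * l / 8 + real (s n + 1) / l"
proof (rule code_stream_memory_bound[OF assms(1) assms(2)[unfolded kmeans_cost_eq_power_cost] assms(3-5),
      where N = "\<lambda>_. n + means_copies n"
      and Z = "\<lambda>i. means_anchor i ` {..<k - 1}" and \<tau> = "means_tail n (k - 1)"])
  have r: "k - 1 \<ge> 2" "k - 1 > 0" using \<open>k \<ge> 3\<close> by simp_all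
  fix i assume i: "i < m"
  have "inj_on (means_anchor i) {..<k - 1}"
    by (auto simp: inj_on_def means_anchor_def split: if_splits)
  then show "card (means_anchor i ` {..<k - 1}) + 1 = k"
    using \<open>k \<ge> 3\<close> by (simp add: card_image)
  show "means_anchor i ` {..<k - 1} \<inter> {0, 4 * (i + 1), 4 * (i + 1) + 1} = {}"
    by (auto simp: means_anchor_def)
  show "means_tail n (k - 1) i t \<in> means_anchor i ` {..<k - 1}" if "t \<ge> n + means_copies n" for t
    unfolding means_tail_def by (rule cyclic_tail_mem[OF r(2) that])
  show "infinite {t. means_tail n (k - 1) i t = a}" if "a \<in> means_anchor i ` {..<k - 1}" for a
    unfolding means_tail_def by (rule cyclic_tail_recurs[OF that])
  fix S S' assume S: "i \<in> S" "i \<notin> S'"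
  let ?N = "n + means_copies n"
  let ?pts = "(\<lambda>a. axis_point (real a) :: real ^ 'd) ` means_anchor i ` {..<k - 1}"
  let ?P = "\<lambda>S. code_stream n m S (means_tail n (k - 1) i) :: nat \<Rightarrow> real ^ 'd"
  define W1 where "W1 = real (means_copies n) + 1"
  define b where "b = 4 * (real i + 1)"
  have W1: "W1 \<ge> 1" by (simp add: W1_def)
  \<comment> \<open>The two means are \<open>1 / W1\<close> apart, so \<open>c\<close> misses one of
    them by at least \<open>1 / (2 * W1)\<close>; weighted by \<open>W1\<close>, the square of this
    is \<eta>.\<close>
  define \<eta> where "\<eta> = 1 / (4 * W1)"
  have \<eta>: "\<eta> > 0" "\<eta> \<le> 1" using W1 by (simp_all add: \<eta>_def field_simps)
  have nin: "axis_point a \<notin> ?pts" if "b \<le> a" "a \<le> b + 1" for a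
    using that by (auto simp: means_anchor_def b_def split: if_splits)
  have "power_cost 2 (?P S) ?N (insert c ?pts) \<ge> power_cost 2 (?P S) ?N (insert (axis_point (b + 1 / W1)) ?pts) + \<eta>
      \<or> power_cost 2 (?P S') ?N (insert c ?pts) \<ge> power_cost 2 (?P S') ?N (insert (axis_point b) ?pts) + \<eta>" for c
  proof -
    have sq: "W1 * d\<^sup>2 \<ge> \<eta>" if "\<bar>d\<bar> \<ge> 1 / (2 * W1)" for d
    proof -
      have "(1 / (2 * W1))\<^sup>2 \<le> d\<^sup>2" using power_mono[OF that, of 2] W1 by simp
      then have "W1 * (1 / (2 * W1))\<^sup>2 \<le> W1 * d\<^sup>2" using W1 by (intro mult_left_mono) auto
      then show ?thesis using W1 by (simp add: \<eta>_def power2_eq_square)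
    qed
    have "1 / W1 = 1 / (2 * W1) + 1 / (2 * W1)" by simp
    then have "\<bar>c $ undefined - (b + 1 / W1)\<bar> \<ge> 1 / (2 * W1) \<or> \<bar>c $ undefined - b\<bar> \<ge> 1 / (2 * W1)"
      by linarith
    then have "min (W1 * (c $ undefined - (b + 1 / W1))\<^sup>2) 1 \<ge> \<eta> \<or> min (W1 * (c $ undefined - b)\<^sup>2) 1 \<ge> \<eta>"
      using sq \<eta>(2) by auto
    moreover have "power_cost 2 (?P S) ?N (insert c ?pts) \<ge>
        power_cost 2 (?P S) ?N (insert (axis_point (b + 1 / W1)) ?pts) + min (W1 * (c $ undefined - (b + 1 / W1))\<^sup>2) 1"
      using means_gap[OF i r(1) assms(7), of S c] S by (simp add: W1_def b_def)
    moreover have "power_cost 2 (?P S') ?N (insert c ?pts) \<ge>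
        power_cost 2 (?P S') ?N (insert (axis_point b) ?pts) + min (W1 * (c $ undefined - b)\<^sup>2) 1"
      using means_gap[OF i r(1) assms(7), of S' c] S by (simp add: W1_def b_def)
    ultimately show ?thesis by linarith
  qed
  moreover have "axis_point (b + 1 / W1) \<notin> ?pts" "axis_point b \<notin> ?pts"
    using W1 by (intro nin; simp)+
  ultimately show "\<exists>\<eta>>0. \<exists>z z'. z \<notin> ?pts \<and> z' \<notin> ?pts \<and>
     (\<forall>c. power_cost 2 (?P S) ?N (insert c ?pts) \<ge> power_cost 2 (?P S) ?N (insert z ?pts) + \<eta>
      \<or> power_cost 2 (?P S') ?N (insert c ?pts) \<ge> power_cost 2 (?P S') ?N (insert z' ?pts) + \<eta>)"
    using \<eta>(1) by blast
qed (use assms in auto)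

theorem theorem10:
  fixes A :: "('r, 'd::finite) streaming_alg"
    and X :: "(real ^ 'd) set"
    and k :: nat and \<delta> :: real and s :: "nat \<Rightarrow> nat"
  assumes "integer_points \<subseteq> X"
    and "\<delta> < 1 / 2"
    and "(k \<ge> 2 \<and> asymptotically_exact kmedian_cost k \<delta> X A) \<or>
         (k \<ge> 3 \<and> asymptotically_exact kmeans_cost k \<delta> X A)"
    and "uses_memory A s"
  shows "(\<lambda>n. real (s n)) \<in> \<Omega>(\<lambda>n. real n)"
proof -
  define \<gamma> where "\<gamma> = 1/2 - \<delta>"
  have "\<gamma> > 0" "\<delta> < 1" using assms(2) by (simp_all add: \<gamma>_def)
  define g where "g = \<gamma>\<^sup>2"
  have "g > 0" using \<open>\<gamma> > 0\<close> by (simp add: g_def)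
  have bound: "2 * g * m \<le> real (s n) + 1" if mn: "4 * m + 1 \<le> n" for m n :: nat
  proof -
    \<comment> \<open>With \<open>l = 4 * \<gamma>\<close>, the term \<open>m * l / 8\<close> uses
      up half of the advantage \<open>\<gamma> * m\<close> over guessing; the other half must be
      paid for by memory.\<close>
    have "4 * \<gamma> > 0" using \<open>\<gamma> > 0\<close> by simp
    then have "(1 - \<delta>) * m \<le> m / 2 + m * (4 * \<gamma>) / 8 + real (s n + 1) / (4 * \<gamma>)"
      using assms(3) median_memory_bound[OF assms(1) _ assms(4) \<open>\<delta> < 1\<close> _ _ mn]
        means_memory_bound[OF assms(1) _ assms(4) \<open>\<delta> < 1\<close> _ _ mn] by blast
    moreover have "(1 - \<delta>) * m - m / 2 - m * (4 * \<gamma>) / 8 = \<gamma> / 2 * m"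
      by (simp add: \<gamma>_def field_simps)
    ultimately have "\<gamma> / 2 * m \<le> real (s n + 1) / (4 * \<gamma>)" by linarith
    then show ?thesis
      using \<open>\<gamma> > 0\<close> by (simp add: g_def power2_eq_square field_simps)
  qed
  \<comment> \<open>The largest admissible \<open>m\<close> is \<open>(n - 1) div 4\<close>, giving
    at least \<open>g / 2 * n - 2 * g - 1\<close> bits. For large \<open>n\<close>, half of the
    linear term absorbs the constants.\<close>
  have "g / 4 * real n \<le> real (s n)" if n: "real n \<ge> (1 + 2 * g) / (g / 4)" for n
  proof -
    have big: "g / 4 * real n \<ge> 1 + 2 * g"
      using n \<open>g > 0\<close> by (simp add: pos_divide_le_eq mult.commute)
    then have "n \<noteq> 0" using \<open>g > 0\<close> by (intro notI) simp
    then have "4 * ((n - 1) div 4) + 1 \<le> n" by linarith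
    then have "2 * g * real ((n - 1) div 4) \<le> real (s n) + 1" by (rule bound)
    moreover have "n \<le> 4 * ((n - 1) div 4) + 4" by linarith
    then have "real n \<le> 4 * real ((n - 1) div 4) + 4" by linarith
    then have "g / 2 * real n \<le> g / 2 * (4 * real ((n - 1) div 4) + 4)"
      using \<open>g > 0\<close> by (intro mult_left_mono) auto
    ultimately show ?thesis using big by (simp add: algebra_simps)
  qed
  then have "\<forall>\<^sub>F n in sequentially. g / 4 * real n \<le> real (s n)"
    by (intro eventually_sequentiallyI[of "nat \<lceil>(1 + 2 * g) / (g / 4)\<rceil>"]) (simp add: nat_ceiling_le_eq)
  then show ?thesis
    using \<open>g > 0\<close> by (intro landau_omega.bigI[of "g / 4"]) (auto elim: eventually_mono)
qed

end
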